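(* Let $(X_i)_{i\in\mathbb Z}$ be a strictly stationary sequence of random variables, defined on a probability space $(\Omega,\mathcal T,\mathbb P)$, with values in a Polish space $E$, with strong mixing coefficients $(\alpha_{\infty,1}(n))_{n\ge0}$, and let $\mu$ be the law of $X_0$. Let $(A_k)_{k>0}$ be a sequence of Borel sets in $E$ with $\mu(A_1)>0$ and $\sum_{k>0}\mu(A_k)=+\infty$. Set $B_k=\{X_k\in A_k\}$ for $k>0$ and $E_n=\sum_{k=1}^n\mu(A_k)$. 1. Let $\eta(x)=x^{-1}\alpha_{\infty,1}([x])$. If $\lim_n E_n^{-1}\eta^{-1}(1/n)=0$, then $(B_k)_{k>0}$ is an $L^1$ Borel-Cantelli sequence. 2. If there exists a sequence $(u_n)_{n>0}$ of positive reals such that $$\sum_{n>0}\frac{\mu(A_n)}{E_n}u_n<\infty\quad\text{and}\quad\sum_{n>0}\frac{\mu(A_n)}{E_n^2}\,\alpha_{\infty,1}^{-1}(E_nu_n/n)<\infty,$$ then $(B_k)_{k>0}$ is a strongly Borel-Cantelli sequence.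
   Context: For events $(B_k)_{k>0}$, write $S_n=\sum_{k=1}^n\mathbf 1_{B_k}$ and $E_n=\mathbb E(S_n)$. $(B_k)_{k>0}$ is an $L^1$ Borel-Cantelli sequence if $\sum_k\mathbb P(B_k)=\infty$ and $\lim_n\|S_n/E_n-1\|_1=0$; it is a strongly Borel-Cantelli sequence if $\sum_k\mathbb P(B_k)=\infty$ and $\lim_nS_n/E_n=1$ a.s. For $\sigma$-fields $\mathcal A,\mathcal B\subset\mathcal T$, $\alpha(\mathcal A,\mathcal B)=\sup\{|\mathbb P(A\cap B)-\mathbb P(A)\mathbb P(B)|:A\in\mathcal A,\ B\in\mathcal B\}$. With $\mathcal F_m=\sigma(X_k:k\le m)$, $\alpha_{\infty,1}(n)=\alpha(\mathcal F_{-n},\sigma(X_0))$, $n\ge 0$, which is non-increasing in $n$. For a non-increasing sequence $(v_n)_{n\in\mathbb N}$ of reals ($\mathbb N=\{0,1,2,\dots\}$), $v^{-1}(u)=\inf\{n\in\mathbb N:v_n\le u\}$ ($=+\infty$ if the set is empty); $\alpha_{\infty,1}^{-1}$ is meant in this sense. $[x]$ is the integer part of $x$, and $\eta^{-1}$ is the generalized inverse of the non-increasing function $\eta$ on $(0,\infty)$: $\eta^{-1}(u)=\inf\{x>0:\eta(x)\le u\}$. *)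

theory Defs
  imports "HOL-Probability.Probability"
begin

text \<open>Sequences indexed by the positive integers are functions on \<^typ>\<open>nat\<close> whose value at
  \<open>0\<close> is never used; series over \<open>n > 0\<close> are written with \<^term>\<open>Suc n\<close>.\<close>

definition hits :: "(nat \<Rightarrow> 'a set) \<Rightarrow> nat \<Rightarrow> 'a \<Rightarrow> real" where
  "hits B n \<omega> = (\<Sum>k=1..n. indicator (B k) \<omega>)"

definition expected_hits :: "'a measure \<Rightarrow> (nat \<Rightarrow> 'a set) \<Rightarrow> nat \<Rightarrow> real" where
  "expected_hits M B n = (\<integral>\<omega>. hits B n \<omega> \<partial>M)"

definition L1_Borel_Cantelli :: "'a measure \<Rightarrow> (nat \<Rightarrow> 'a set) \<Rightarrow> bool" where
  "L1_Borel_Cantelli M B \<longleftrightarrow>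
     (\<forall>k>0. B k \<in> sets M) \<and>
     (\<Sum>k. emeasure M (B (Suc k))) = \<infinity> \<and>
     (\<lambda>n. \<integral>\<omega>. \<bar>hits B n \<omega> / expected_hits M B n - 1\<bar> \<partial>M) \<longlonglongrightarrow> 0"

definition strongly_Borel_Cantelli :: "'a measure \<Rightarrow> (nat \<Rightarrow> 'a set) \<Rightarrow> bool" where
  "strongly_Borel_Cantelli M B \<longleftrightarrow>
     (\<forall>k>0. B k \<in> sets M) \<and>
     (\<Sum>k. emeasure M (B (Suc k))) = \<infinity> \<and>
     (AE \<omega> in M. (\<lambda>n. hits B n \<omega> / expected_hits M B n) \<longlonglongrightarrow> 1)"

definition strictly_stationary ::
    "'a measure \<Rightarrow> (int \<Rightarrow> 'a \<Rightarrow> 'e::topological_space) \<Rightarrow> bool" where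
  "strictly_stationary M X \<longleftrightarrow>
     (\<forall>k. distr M (\<Pi>\<^sub>M i\<in>UNIV. borel) (\<lambda>\<omega> i. X (i + k) \<omega>) =
          distr M (\<Pi>\<^sub>M i\<in>UNIV. borel) (\<lambda>\<omega> i. X i \<omega>))"

definition generated_sigma ::
    "'a measure \<Rightarrow> (int \<Rightarrow> 'a \<Rightarrow> 'e::topological_space) \<Rightarrow> int set \<Rightarrow> 'a set set" where
  "generated_sigma M X I =
     sigma_sets (space M) (\<Union>i\<in>I. {X i -` C \<inter> space M | C. C \<in> sets borel})"

definition strong_mixing_coeff :: "'a measure \<Rightarrow> 'a set set \<Rightarrow> 'a set set \<Rightarrow> real" where
  "strong_mixing_coeff M \<A> \<B> =
     (SUP (A, B) \<in> \<A> \<times> \<B>. \<bar>measure M (A \<inter> B) - measure M A * measure M B\<bar>)"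

definition alpha_inf_1 ::
    "'a measure \<Rightarrow> (int \<Rightarrow> 'a \<Rightarrow> 'e::topological_space) \<Rightarrow> nat \<Rightarrow> real" where
  "alpha_inf_1 M X n =
     strong_mixing_coeff M (generated_sigma M X {..- int n}) (generated_sigma M X {0})"

text \<open>In \<^typ>\<open>enat\<close> the infimum of the empty set is \<open>\<infinity>\<close>.\<close>

definition seq_inverse :: "(nat \<Rightarrow> real) \<Rightarrow> real \<Rightarrow> enat" where
  "seq_inverse v u = Inf {enat n | n. v n \<le> u}"

text \<open>This infimum of reals is only meaningful when the set is nonempty; for
  \<open>\<eta>(x) = \<alpha>([x]) / x\<close> with bounded \<open>\<alpha>\<close> this is so for every \<open>u > 0\<close>.\<close>

definition fun_inverse :: "(real \<Rightarrow> real) \<Rightarrow> real \<Rightarrow> real" where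
  "fun_inverse \<eta> u = Inf {x. x > 0 \<and> \<eta> x \<le> u}"

end

theory Submission
  imports Defs "HOL-Real_Asymp.Real_Asymp"
begin

text \<open>Let \<open>F\<^sub>i = \<sigma>(X\<^sub>j : j \<le> i)\<close>. For every \<open>m\<close>, split \<open>S\<^sub>n - E\<^sub>n = D + R\<close>, where \<open>D\<close> is the sum of
  \<open>1\<^bsub>B\<^sub>k\<^esub> - P(B\<^sub>k | F\<^bsub>k-m\<^esub>)\<close> and \<open>R\<close> the sum of \<open>P(B\<^sub>k | F\<^bsub>k-m\<^esub>) - P(B\<^sub>k)\<close> over \<open>k \<le> n\<close>. The terms of \<open>D\<close> are
  orthogonal at distance at least \<open>m\<close>, so \<open>\<parallel>D\<parallel>\<^sub>2\<^sup>2 \<le> 2 m E\<^sub>n\<close>, while \<open>\<parallel>R\<parallel>\<^sub>1 \<le> 2 n \<alpha>(m)\<close> by mixing.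

  For the first part take \<open>m = [x]\<close> with \<open>\<eta>(x) \<le> 1/n\<close> and \<open>x = o(E\<^sub>n)\<close>: both terms are \<open>o(E\<^sub>n)\<close>.
  For the second part put \<open>m\<^sub>n = \<alpha>\<^sup>-\<^sup>1(E\<^sub>n u\<^sub>n / n)\<close> and \<open>g\<^sub>n = u\<^sub>n + m\<^sub>n / E\<^sub>n\<close>. By hypothesis
  \<open>\<Sum> \<mu>(A\<^sub>n) g\<^sub>n / E\<^sub>n < \<infinity>\<close>, and for \<open>q > 1\<close> the weights \<open>\<mu>(A\<^sub>n) / E\<^sub>n\<close> have mass bounded below on each block
  \<open>{n. q\<^sup>j < E\<^sub>n \<le> q\<^sup>j\<^sup>+\<^sup>1}\<close>. Hence minimizing \<open>g\<close> over each block gives a subsequence on which \<open>g\<close> is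
  summable, so that \<open>S/E \<rightarrow> 1\<close> almost surely along it; monotonicity of \<open>S\<close> and \<open>E\<close> bounds \<open>S\<^sub>n/E\<^sub>n\<close>
  between powers of \<open>q\<close> for all other large \<open>n\<close>, and \<open>q\<close> is arbitrary.\<close>

section \<open>Martingale-type decomposition of the number of hits\<close>

lemma (in prob_space) bounded_cond_prob:
  assumes F: "subalgebra M F" and A: "A \<in> sets M"
  obtains Z :: "'a \<Rightarrow> real" where "Z \<in> borel_measurable F" "\<And>x. 0 \<le> Z x" "\<And>x. Z x \<le> 1"
    "\<And>f C. f \<in> borel_measurable F \<Longrightarrow> (\<And>x. \<bar>f x\<bar> \<le> C) \<Longrightarrow>
        (\<integral>x. f x * Z x \<partial>M) = (\<integral>x. f x * indicator A x \<partial>M)"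
proof -
  interpret finite_measure_subalgebra M F
    by standard (fact F)
  have iA: "integrable M (indicator A :: 'a \<Rightarrow> real)"
    using A by (simp add: integrable_real_indicator emeasure_eq_measure)
  define W where "W = real_cond_exp M F (indicator A)"
  have W [measurable]: "W \<in> borel_measurable F"
    unfolding W_def by simp
  define Z where "Z = (\<lambda>x. min 1 (max 0 (W x)))"
  have ZF: "Z \<in> borel_measurable F"
    unfolding Z_def by measurable
  have "AE x in M. 0 \<le> W x" "AE x in M. W x \<le> 1"
    unfolding W_def
    by (rule real_cond_exp_ge_c[OF iA] real_cond_exp_le_c[OF iA]; simp add: indicator_def)+
  then have WZ: "AE x in M. W x = Z x"
    by eventually_elim (simp add: Z_def)
  show thesis
  proof (rule that[of Z])
    fix f :: "'a \<Rightarrow> real" and C assume f: "f \<in> borel_measurable F" and C: "\<And>x. \<bar>f x\<bar> \<le> C"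
    have fM [measurable]: "f \<in> borel_measurable M"
      using f F measurable_from_subalg by blast
    have WM [measurable]: "W \<in> borel_measurable M"
      using W F measurable_from_subalg by blast
    have ZM [measurable]: "Z \<in> borel_measurable M"
      using ZF F measurable_from_subalg by blast
    have "(\<integral>x. f x * Z x \<partial>M) = (\<integral>x. f x * W x \<partial>M)"
      by (rule integral_cong_AE) (use WZ in auto)
    also have "\<dots> = (\<integral>x. f x * indicator A x \<partial>M)"
      unfolding W_def
    proof (rule real_cond_exp_intg)
      show "integrable M (\<lambda>x. f x * indicator A x)"
      proof (rule integrable_const_bound[where B = C])
        show "AE x in M. norm (f x * indicator A x) \<le> C"
          using C order_trans[OF abs_ge_zero C] by (auto simp: indicator_def)
      qed (use A in measurable)
    qed (use f A in auto)
    finally show "(\<integral>x. f x * Z x \<partial>M) = (\<integral>x. f x * indicator A x \<partial>M)" .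
  qed (use ZF in \<open>auto simp: Z_def\<close>)
qed

lemma (in prob_space) L1_cond_prob_deviation:
  fixes Z :: "'a \<Rightarrow> real"
  assumes F: "subalgebra M F" and A: "A \<in> sets M"
    and Z: "Z \<in> borel_measurable F" "\<And>x. 0 \<le> Z x" "\<And>x. Z x \<le> 1"
    and cond: "\<And>G. G \<in> sets F \<Longrightarrow> (\<integral>x. indicator G x * Z x \<partial>M) = prob (G \<inter> A)"
    and mix: "\<And>G. G \<in> sets F \<Longrightarrow> \<bar>prob (G \<inter> A) - prob G * prob A\<bar> \<le> a"
  shows "(\<integral>x. \<bar>Z x - prob A\<bar> \<partial>M) \<le> 2 * a"
proof -
  define G where "G = {x \<in> space F. prob A < Z x}"
  define H where "H = {x \<in> space F. Z x \<le> prob A}"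
  have sp: "space F = space M"
    using F by (simp add: subalgebra_def)
  have GF: "G \<in> sets F" and HF: "H \<in> sets F"
    unfolding G_def H_def using Z(1) by measurable
  have [measurable]: "G \<in> sets M" "H \<in> sets M"
    using GF HF F by (auto simp: subalgebra_def)
  have [measurable]: "Z \<in> borel_measurable M"
    using Z(1) F measurable_from_subalg by blast
  have int: "integrable M (\<lambda>x. indicator K x * Z x)" "integrable M (\<lambda>x. indicator K x * prob A)"
    if [measurable]: "K \<in> sets M" for K
    using Z(2,3) by (intro integrable_const_bound[where B = 1]; auto simp: indicator_def)+
  have part: "(\<integral>x. indicator K x * Z x - indicator K x * prob A \<partial>M) = prob (K \<inter> A) - prob K * prob A"
    if "K \<in> sets F" "K \<in> sets M" for K
    using int[OF that(2)] cond[OF that(1)] that by simp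
  have "(\<integral>x. \<bar>Z x - prob A\<bar> \<partial>M) =
      (\<integral>x. (indicator G x * Z x - indicator G x * prob A) -
            (indicator H x * Z x - indicator H x * prob A) \<partial>M)"
    by (rule Bochner_Integration.integral_cong) (auto simp: G_def H_def sp indicator_def)
  also have "\<dots> = (prob (G \<inter> A) - prob G * prob A) - (prob (H \<inter> A) - prob H * prob A)"
    using part[OF GF] part[OF HF] int by (subst Bochner_Integration.integral_diff) auto
  also have "\<dots> \<le> 2 * a"
    using mix[OF GF] mix[OF HF] by linarith
  finally show ?thesis .
qed

lemma sum_band_le:
  fixes p :: "nat \<Rightarrow> real"
  assumes p: "\<And>k. 0 \<le> p k"
  shows "(\<Sum>k=1..n. \<Sum>l=1..n. if k < l + m \<and> l < k + m then (p k + p l) / 2 else 0)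
          \<le> 2 * real m * (\<Sum>k=1..n. p k)"
proof -
  let ?b = "\<lambda>k l. k < l + m \<and> l < k + m"
  have half: "(\<Sum>k=1..n. \<Sum>l=1..n. if ?b k l then p k else 0) \<le> 2 * real m * (\<Sum>k=1..n. p k)"
  proof -
    have "(\<Sum>l=1..n. if ?b k l then p k else 0) \<le> 2 * real m * p k" for k
    proof -
      have "{l\<in>{1..n}. ?b k l} \<subseteq> {k + 1 - m..<k + m}"
        by auto
      then have "card {l\<in>{1..n}. ?b k l} \<le> card {k + 1 - m..<k + m}"
        by (intro card_mono) auto
      then have c: "card {l\<in>{1..n}. ?b k l} \<le> 2 * m"
        by simp
      have "(\<Sum>l=1..n. if ?b k l then p k else 0) = real (card {l\<in>{1..n}. ?b k l}) * p k"
        by (simp add: sum.If_cases Int_def)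
      also have "\<dots> \<le> real (2 * m) * p k"
        using c p by (intro mult_right_mono) (simp_all only: of_nat_le_iff)
      finally show ?thesis by simp
    qed
    then show ?thesis
      unfolding sum_distrib_left by (rule sum_mono)
  qed
  have "(\<Sum>k=1..n. \<Sum>l=1..n. if ?b k l then p l else 0) =
        (\<Sum>k=1..n. \<Sum>l=1..n. if ?b k l then p k else 0)"
    by (subst sum.swap) (simp add: conj_commute)
  moreover have "(\<Sum>k=1..n. \<Sum>l=1..n. if ?b k l then (p k + p l) / 2 else 0) =
     ((\<Sum>k=1..n. \<Sum>l=1..n. if ?b k l then p k else 0) +
      (\<Sum>k=1..n. \<Sum>l=1..n. if ?b k l then p l else 0)) / 2"
    unfolding sum.distrib[symmetric] sum_divide_distrib by (intro sum.cong) auto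
  ultimately show ?thesis
    using half by simp
qed

lemma (in prob_space) hits_decomposition:
  fixes F :: "int \<Rightarrow> 'a measure"
  assumes F: "\<And>i. subalgebra M (F i)"
    and mono: "\<And>i j. i \<le> j \<Longrightarrow> sets (F i) \<subseteq> sets (F j)"
    and B: "\<And>k. k > 0 \<Longrightarrow> B k \<in> sets (F (int k))"
    and mix: "\<And>k G. k > 0 \<Longrightarrow> G \<in> sets (F (int k - int m)) \<Longrightarrow>
               \<bar>prob (G \<inter> B k) - prob G * prob (B k)\<bar> \<le> a"
  obtains D R :: "'a \<Rightarrow> real" where
    "\<And>x. hits B n x - (\<Sum>k=1..n. prob (B k)) = D x + R x"
    "D \<in> borel_measurable M" "integrable M (\<lambda>x. (D x)\<^sup>2)" "integrable M R"
    "(\<integral>x. (D x)\<^sup>2 \<partial>M) \<le> 2 * real m * (\<Sum>k=1..n. prob (B k))"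
    "(\<integral>x. \<bar>R x\<bar> \<partial>M) \<le> 2 * real n * a"
proof -
  have BM: "B k \<in> sets M" if "k > 0" for k
    using B[OF that] F[of "int k"] by (auto simp: subalgebra_def)
  define P where "P k Z \<longleftrightarrow> Z \<in> borel_measurable (F (int k - int m)) \<and> (\<forall>x. 0 \<le> Z x \<and> Z x \<le> 1) \<and>
      (\<forall>f C. f \<in> borel_measurable (F (int k - int m)) \<longrightarrow> (\<forall>x. \<bar>f x\<bar> \<le> C) \<longrightarrow>
        (\<integral>x. f x * Z x \<partial>M) = (\<integral>x. f x * indicator (B k) x \<partial>M))" for k and Z :: "'a \<Rightarrow> real"
  have "\<exists>Z. P k Z" if k: "k > 0" for k
  proof (rule bounded_cond_prob[OF F BM[OF k], of "int k - int m"], goal_cases)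
    case (1 Z)
    show ?case
      unfolding P_def by (intro exI[of _ Z] conjI allI impI; rule 1; blast)
  qed
  then have "\<forall>k. \<exists>Z. k > 0 \<longrightarrow> P k Z"
    by blast
  from choice[OF this] obtain Z where Z: "\<And>k. k > 0 \<Longrightarrow> P k (Z k)"
    by blast
  have ZF: "Z k \<in> borel_measurable (F (int k - int m))"
    and Zb: "\<And>x. 0 \<le> Z k x \<and> Z k x \<le> 1" if "k > 0" for k
    using Z[OF that] unfolding P_def by auto
  have Zc: "(\<integral>x. f x * Z k x \<partial>M) = (\<integral>x. f x * indicator (B k) x \<partial>M)"
    if "k > 0" "f \<in> borel_measurable (F (int k - int m))" "\<And>x. \<bar>f x\<bar> \<le> C" for k f C
    using Z[OF that(1)] that(2,3) unfolding P_def by blast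
  have sub: "f \<in> borel_measurable (F j)" if "f \<in> borel_measurable (F i)" "i \<le> j"
    for f :: "'a \<Rightarrow> real" and i j
    using that mono[of i j] F
    by (intro measurable_from_subalg[OF _ that(1)]) (simp add: subalgebra_def)
  have ZM: "Z k \<in> borel_measurable M" if "k > 0" for k
    using ZF[OF that] F measurable_from_subalg by blast
  define Y where "Y k x = indicator (B k) x - Z k x" for k x
  have YF: "Y k \<in> borel_measurable (F (int k))" if "k > 0" for k
  proof -
    have [measurable]: "Z k \<in> borel_measurable (F (int k))" "B k \<in> sets (F (int k))"
      using sub[OF ZF] B that by auto
    show ?thesis unfolding Y_def by measurable
  qed
  have YM: "Y k \<in> borel_measurable M" if "k > 0" for k
    using YF[OF that] F measurable_from_subalg by blast
  have Yb: "\<bar>Y k x\<bar> \<le> 1" if "k > 0" for k x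
    using Zb[OF that, of x] by (auto simp: Y_def indicator_def)
  have iYY: "integrable M (\<lambda>x. Y k x * Y l x)" if "k > 0" "l > 0" for k l
    using YM that Yb
    by (intro integrable_const_bound[where B = 1]) (auto simp: abs_mult intro!: mult_le_one)
  have iZ: "integrable M (Z k)" if "k > 0" for k
    using ZM Zb that by (intro integrable_const_bound[where B = 1]) auto
  have ort: "(\<integral>x. Y l x * Y k x \<partial>M) = 0" if "k > 0" "l > 0" "l + m \<le> k" for k l
  proof -
    have Yl: "Y l \<in> borel_measurable (F (int k - int m))"
      using that by (intro sub[OF YF]) auto
    have "(\<integral>x. Y l x * Y k x \<partial>M) = (\<integral>x. Y l x * indicator (B k) x - Y l x * Z k x \<partial>M)"
      by (simp add: Y_def algebra_simps)
    also have "\<dots> = (\<integral>x. Y l x * indicator (B k) x \<partial>M) - (\<integral>x. Y l x * Z k x \<partial>M)"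
    proof (rule Bochner_Integration.integral_diff)
      show "integrable M (\<lambda>x. Y l x * indicator (B k) x)"
        using YM[OF that(2)] Yb[OF that(2)] BM[OF that(1)]
        by (intro integrable_const_bound[where B = 1]) (auto simp: indicator_def)
      show "integrable M (\<lambda>x. Y l x * Z k x)"
        using YM[OF that(2)] Yb[OF that(2)] ZM[OF that(1)] Zb[OF that(1)]
        by (intro integrable_const_bound[where B = 1]) (auto simp: abs_mult intro!: mult_le_one)
    qed
    also have "\<dots> = 0"
      using Zc[OF that(1) Yl Yb[OF that(2)]] by simp
    finally show ?thesis .
  qed
  have sq: "(\<integral>x. Y k x * Y k x \<partial>M) \<le> prob (B k)" if k: "k > 0" for k
  proof -
    note [measurable] = BM[OF k] ZM[OF k]
    have i: "integrable M (\<lambda>x. Z k x * indicator (B k) x)" "integrable M (\<lambda>x. Z k x * Z k x)"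
      "integrable M (\<lambda>x. indicator (B k) x :: real)"
      using Zb[OF k] by (intro integrable_const_bound[where B = 1];
          auto simp: indicator_def abs_mult intro!: mult_le_one)+
    have "(\<integral>x. Y k x * Y k x \<partial>M) =
       (\<integral>x. indicator (B k) x - 2 * (Z k x * indicator (B k) x) + Z k x * Z k x \<partial>M)"
      by (rule Bochner_Integration.integral_cong) (auto simp: Y_def algebra_simps indicator_def)
    also have "\<dots> = prob (B k) - 2 * (\<integral>x. Z k x * indicator (B k) x \<partial>M) + (\<integral>x. Z k x * Z k x \<partial>M)"
      using i by simp
    also have "(\<integral>x. Z k x * Z k x \<partial>M) = (\<integral>x. Z k x * indicator (B k) x \<partial>M)"
      using Zb[OF k] by (intro Zc[OF k ZF[OF k], of 1]) auto
    also have "prob (B k) - 2 * (\<integral>x. Z k x * indicator (B k) x \<partial>M) + (\<integral>x. Z k x * indicator (B k) x \<partial>M)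
        \<le> prob (B k)"
      using Zb[OF k] by (simp add: Bochner_Integration.integral_nonneg)
    finally show ?thesis .
  qed
  have cov: "(\<integral>x. Y k x * Y l x \<partial>M) \<le>
      (if k < l + m \<and> l < k + m then (prob (B k) + prob (B l)) / 2 else 0)"
    if kl: "k > 0" "l > 0" for k l
  proof (cases "k < l + m \<and> l < k + m")
    case True
    have "(\<integral>x. Y k x * Y l x \<partial>M) \<le> (\<integral>x. (Y k x * Y k x + Y l x * Y l x) / 2 \<partial>M)"
    proof (intro integral_mono)
      show "Y k x * Y l x \<le> (Y k x * Y k x + Y l x * Y l x) / 2" for x
        using sum_squares_bound[of "Y k x" "Y l x"] by (simp add: power2_eq_square)
    qed (use iYY kl in auto)
    also have "\<dots> = ((\<integral>x. Y k x * Y k x \<partial>M) + (\<integral>x. Y l x * Y l x \<partial>M)) / 2"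
      using iYY kl by simp
    also have "\<dots> \<le> (prob (B k) + prob (B l)) / 2"
      using sq kl by (simp add: add_mono)
    finally show ?thesis using True by simp
  next
    case False
    then have "l + m \<le> k \<or> k + m \<le> l" by auto
    then have "(\<integral>x. Y k x * Y l x \<partial>M) = 0"
      using ort[of k l] ort[of l k] kl by (auto simp: mult.commute)
    then show ?thesis using False by auto
  qed
  define D where "D x = (\<Sum>k=1..n. Y k x)" for x
  define R where "R x = (\<Sum>k=1..n. Z k x - prob (B k))" for x
  have D2: "(D x)\<^sup>2 = (\<Sum>k=1..n. \<Sum>l=1..n. Y k x * Y l x)" for x
    by (simp add: D_def power2_eq_square sum_product)
  show thesis
  proof (rule that[of D R])
    show "hits B n x - (\<Sum>k=1..n. prob (B k)) = D x + R x" for x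
      by (simp add: hits_def D_def R_def Y_def sum_subtractf)
    show "D \<in> borel_measurable M"
      unfolding D_def using YM by (intro borel_measurable_sum) auto
    show "integrable M (\<lambda>x. (D x)\<^sup>2)"
      unfolding D2 using iYY by (intro Bochner_Integration.integrable_sum) auto
    show "integrable M R"
      unfolding R_def using iZ
      by (intro Bochner_Integration.integrable_sum Bochner_Integration.integrable_diff) auto
    have "(\<integral>x. (D x)\<^sup>2 \<partial>M) = (\<Sum>k=1..n. \<Sum>l=1..n. \<integral>x. Y k x * Y l x \<partial>M)"
      unfolding D2 using iYY
      by (subst Bochner_Integration.integral_sum; intro Bochner_Integration.integrable_sum
            Bochner_Integration.integral_sum sum.cong refl) auto
    also have "\<dots> \<le> (\<Sum>k=1..n. \<Sum>l=1..n.
        if k < l + m \<and> l < k + m then (prob (B k) + prob (B l)) / 2 else 0)"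
      using cov by (intro sum_mono) auto
    also have "\<dots> \<le> 2 * real m * (\<Sum>k=1..n. prob (B k))"
      by (rule sum_band_le) simp
    finally show "(\<integral>x. (D x)\<^sup>2 \<partial>M) \<le> 2 * real m * (\<Sum>k=1..n. prob (B k))" .
    have Rk: "(\<integral>x. \<bar>Z k x - prob (B k)\<bar> \<partial>M) \<le> 2 * a" if k: "k > 0" for k
    proof (rule L1_cond_prob_deviation[OF F BM[OF k] ZF[OF k]])
      fix G assume G: "G \<in> sets (F (int k - int m))"
      then have "G \<in> sets M"
        using F by (auto simp: subalgebra_def)
      then have "(\<integral>x. indicator G x * indicator (B k) x \<partial>M) = prob (G \<inter> B k)"
        using BM[OF k] by (simp flip: indicator_inter_arith)
      then show "(\<integral>x. indicator G x * Z k x \<partial>M) = prob (G \<inter> B k)"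
        using Zc[OF k, of "indicator G" 1] G by (simp add: indicator_def)
    qed (use Zb mix k in auto)
    have "(\<integral>x. \<bar>R x\<bar> \<partial>M) \<le> (\<integral>x. (\<Sum>k=1..n. \<bar>Z k x - prob (B k)\<bar>) \<partial>M)"
      using iZ unfolding R_def
      by (intro integral_mono sum_abs Bochner_Integration.integrable_sum integrable_abs
          Bochner_Integration.integrable_diff) auto
    also have "\<dots> = (\<Sum>k=1..n. \<integral>x. \<bar>Z k x - prob (B k)\<bar> \<partial>M)"
      using iZ by (intro Bochner_Integration.integral_sum integrable_abs
          Bochner_Integration.integrable_diff) auto
    also have "\<dots> \<le> (\<Sum>k=1..n. 2 * a)"
      using Rk by (intro sum_mono) auto
    finally show "(\<integral>x. \<bar>R x\<bar> \<partial>M) \<le> 2 * real n * a"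
      by (simp add: mult_ac)
  qed
qed

section \<open>Geometric subsequences\<close>

lemma power_interval:
  fixes q x :: real
  assumes q: "1 < q" and x: "1 < x"
  obtains j where "q ^ j < x" "x \<le> q ^ Suc j"
proof -
  obtain k where k: "x \<le> q ^ k"
    using real_arch_pow[OF q] less_imp_le by blast
  define j where "j = (LEAST k. x \<le> q ^ k)"
  have xj: "x \<le> q ^ j"
    unfolding j_def using k by (rule LeastI)
  then have "j \<noteq> 0"
    using x by (auto intro: ccontr)
  then obtain i where i: "j = Suc i"
    using not0_implies_Suc by blast
  have "\<not> x \<le> q ^ i"
    using not_less_Least[of i "\<lambda>k. x \<le> q ^ k"] i by (simp add: j_def)
  with xj i show thesis by (intro that[of i]) auto
qed

lemma ratio_bounds_from_subsequence:
  fixes S E :: "nat \<Rightarrow> real"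
  assumes S: "mono S" "\<And>n. 0 \<le> S n" and E: "mono E" "filterlim E at_top sequentially"
    and q: "1 < q"
    and r: "\<forall>\<^sub>F j in sequentially. q ^ j < E (r j) \<and> E (r j) \<le> q ^ Suc j"
    and lim: "(\<lambda>j. S (r j) / E (r j)) \<longlonglongrightarrow> 1"
  shows "\<forall>\<^sub>F n in sequentially. 1 / q ^ 3 \<le> S n / E n \<and> S n / E n \<le> q ^ 3"
proof -
  have "\<forall>\<^sub>F j in sequentially. 1 / q < S (r j) / E (r j)" "\<forall>\<^sub>F j in sequentially. S (r j) / E (r j) < q"
    using order_tendstoD[OF lim] q by auto
  with r have "\<forall>\<^sub>F j in sequentially. (q ^ j < E (r j) \<and> E (r j) \<le> q ^ Suc j) \<and>
      1 / q < S (r j) / E (r j) \<and> S (r j) / E (r j) < q"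
    by eventually_elim auto
  then obtain J where J: "\<And>j. j \<ge> J \<Longrightarrow> q ^ j < E (r j)" "\<And>j. j \<ge> J \<Longrightarrow> E (r j) \<le> q ^ Suc j"
    "\<And>j. j \<ge> J \<Longrightarrow> 1 / q < S (r j) / E (r j)" "\<And>j. j \<ge> J \<Longrightarrow> S (r j) / E (r j) < q"
    unfolding eventually_sequentially by blast
  have "\<forall>\<^sub>F n in sequentially. q ^ (J + 2) < E n"
    using E(2) by (simp add: filterlim_at_top_dense)
  then show ?thesis
  proof eventually_elim
    case (elim n)
    have "1 \<le> q ^ (J + 2)"
      using q by (intro one_le_power) auto
    then obtain j where j: "q ^ j < E n" "E n \<le> q ^ Suc j"
      using power_interval[OF q, of "E n"] elim by auto
    have En: "0 < E n"
      using \<open>1 \<le> q ^ (J + 2)\<close> elim by linarith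
    have "q ^ (J + 2) < q ^ Suc j"
      using elim j by linarith
    then have "J + 2 < Suc j"
      using q by (simp only: power_strict_increasing_iff)
    then obtain i where i: "j = Suc i" "i \<ge> J"
      by (cases j) auto
    have qp: "0 < q ^ k" for k
      using q by simp
    have "E (r i) < E n"
      using J(2)[OF i(2)] j i by simp
    then have "r i \<le> n"
      using E(1) by (meson linorder_le_cases monoD not_le)
    have "E n < E (r (Suc j))"
      using J(1)[of "Suc j"] j i by simp
    then have "n \<le> r (Suc j)"
      using E(1) by (meson linorder_le_cases monoD not_le)
    have Ei: "0 < E (r i)"
      using J(1)[OF i(2)] qp[of i] by linarith
    have Ej: "0 < E (r (Suc j))"
      using \<open>E n < E (r (Suc j))\<close> En by linarith
    have "S n \<le> S (r (Suc j))"
      using S(1) \<open>n \<le> r (Suc j)\<close> by (rule monoD)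
    also have "\<dots> \<le> q * E (r (Suc j))"
      using J(4)[of "Suc j"] i Ej by (simp add: field_simps)
    also have "\<dots> \<le> q * q ^ Suc (Suc j)"
      using J(2)[of "Suc j"] i q by (intro mult_left_mono) auto
    also have "\<dots> = q ^ 3 * q ^ j"
      by (simp add: power3_eq_cube)
    also have "\<dots> \<le> q ^ 3 * E n"
      using j q by (intro mult_left_mono) auto
    finally have up: "S n / E n \<le> q ^ 3"
      using En by (simp add: field_simps)
    have "E n \<le> q ^ Suc (Suc i)"
      using j i by simp
    also have "\<dots> = q ^ 2 * q ^ i"
      by (simp add: power2_eq_square)
    also have "\<dots> \<le> q ^ 2 * E (r i)"
      using J(1)[OF i(2)] q by (intro mult_left_mono) auto
    also have "\<dots> \<le> q ^ 2 * (q * S (r i))"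
      using J(3)[OF i(2)] Ei q by (intro mult_left_mono) (auto simp: field_simps)
    also have "\<dots> \<le> q ^ 2 * (q * S n)"
      using q monoD[OF S(1) \<open>r i \<le> n\<close>] by (intro mult_left_mono) auto
    also have "\<dots> = q ^ 3 * S n"
      by (simp add: power3_eq_cube power2_eq_square)
    finally have "1 / q ^ 3 \<le> S n / E n"
      using En q by (simp add: field_simps)
    with up show ?case by simp
  qed
qed

lemma tendsto_one_if_power_bounds:
  fixes f :: "nat \<Rightarrow> real"
  assumes f: "\<And>i :: nat. \<forall>\<^sub>F n in sequentially.
      1 / (1 + 1 / real (Suc i)) ^ 3 \<le> f n \<and> f n \<le> (1 + 1 / real (Suc i)) ^ 3"
  shows "f \<longlonglongrightarrow> 1"
proof (rule order_tendstoI)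
  fix a :: real assume a: "a < 1"
  have "(\<lambda>i. 1 / (1 + 1 / real (Suc i)) ^ 3) \<longlonglongrightarrow> 1"
    by real_asymp
  from order_tendstoD(1)[OF this a] obtain i where "a < 1 / (1 + 1 / real (Suc i)) ^ 3"
    using eventually_happens' sequentially_bot by blast
  with f[of i] show "\<forall>\<^sub>F n in sequentially. a < f n"
    by (auto elim!: eventually_mono)
next
  fix a :: real assume a: "1 < a"
  have "(\<lambda>i. (1 + 1 / real (Suc i)) ^ 3) \<longlonglongrightarrow> 1"
    by real_asymp
  from order_tendstoD(2)[OF this a] obtain i where "(1 + 1 / real (Suc i)) ^ 3 < a"
    using eventually_happens' sequentially_bot by blast
  with f[of i] show "\<forall>\<^sub>F n in sequentially. f n < a"
    by (auto elim!: eventually_mono)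
qed

lemma good_index_in_block:
  fixes a g :: "nat \<Rightarrow> real"
  defines "E \<equiv> \<lambda>n. \<Sum>k=1..n. a k"
  assumes a: "\<And>k. 0 \<le> a k" "\<And>k. a k \<le> 1" and unb: "filterlim E at_top sequentially"
    and b: "0 \<le> b" "b < c" and w: "0 < w" "w * c \<le> c - b - 1" and g: "\<And>k. 0 \<le> g k"
  obtains n where "b < E n" "E n \<le> c" "0 < a n" "0 < n" "finite {k. b < E k \<and> E k \<le> c}"
    "w * g n \<le> (\<Sum>k | b < E k \<and> E k \<le> c. a k / E k * g k)"
proof -
  let ?I = "{k. b < E k \<and> E k \<le> c}"
  have mono: "E m \<le> E n" if "m \<le> n" for m n
    unfolding E_def using that a by (intro sum_mono2) auto
  have step: "E (Suc n) = E n + a (Suc n)" for n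
    by (simp add: E_def)
  have E0: "E 0 = 0"
    by (simp add: E_def)
  have ex: "\<exists>N. E N \<le> y \<and> y < E (Suc N) \<and> (\<forall>k. E k \<le> y \<longleftrightarrow> k \<le> N)" if "0 \<le> y" for y
  proof -
    obtain N where N: "y < E N"
      using filterlim_at_top_dense[THEN iffD1, OF unb, rule_format, of y]
        eventually_happens' sequentially_bot by blast
    define K where "K = (LEAST k. y < E k)"
    have K: "y < E K"
      unfolding K_def using N by (rule LeastI)
    have less: "E k \<le> y" if "k < K" for k
      using not_less_Least[of k "\<lambda>k. y < E k"] that by (simp add: K_def not_less)
    have "K \<noteq> 0"
      using K E0 \<open>0 \<le> y\<close> by (intro notI) auto
    then obtain N where N: "K = Suc N"
      using not0_implies_Suc by blast
    show ?thesis
    proof (intro exI[of _ N] conjI allI iffI)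
      fix k assume "E k \<le> y"
      show "k \<le> N"
      proof (rule ccontr)
        assume "\<not> k \<le> N"
        then have "E K \<le> E k"
          using N by (intro mono) simp
        with \<open>E k \<le> y\<close> K show False by simp
      qed
    qed (use N K less in auto)
  qed
  obtain N1 where N1: "E N1 \<le> b" "b < E (Suc N1)" "\<And>k. E k \<le> b \<longleftrightarrow> k \<le> N1"
    using ex[OF b(1)] by blast
  obtain N2 where N2: "E N2 \<le> c" "c < E (Suc N2)" "\<And>k. E k \<le> c \<longleftrightarrow> k \<le> N2"
    using ex[of c] b by auto
  have I: "?I = {Suc N1..N2}"
    using N1(3) N2(3) by (auto simp: not_le[symmetric] Suc_le_eq)
  have "N1 \<le> N2"
    using N1(1) N2(3) b by fastforce
  have "E N2 = E N1 + sum a {Suc N1..N2}"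
    unfolding E_def using sum.ub_add_nat[of 1 N1 a "N2 - N1"] \<open>N1 \<le> N2\<close> by simp
  moreover have "c - 1 < E N2"
    using N2(2) step[of N2] a(2)[of "Suc N2"] by linarith
  ultimately have sumI: "c - b - 1 < sum a ?I"
    using N1(1) unfolding I by linarith
  have fin: "finite ?I"
    unfolding I by simp
  have c: "0 < c"
    using b by linarith
  have wt: "w \<le> (\<Sum>k\<in>?I. a k / E k)" and pos: "0 < sum a ?I"
  proof -
    have "w \<le> sum a ?I / c"
      using sumI w c by (simp add: field_simps)
    also have "\<dots> \<le> (\<Sum>k\<in>?I. a k / E k)"
      unfolding sum_divide_distrib using a b
      by (intro sum_mono divide_left_mono mult_pos_pos) auto
    finally show "w \<le> (\<Sum>k\<in>?I. a k / E k)" .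
    show "0 < sum a ?I"
      using sumI w c mult_pos_pos[OF w(1) c] by linarith
  qed
  let ?P = "{k\<in>?I. 0 < a k}"
  have "?P \<noteq> {}"
  proof
    assume "?P = {}"
    then have "sum a ?I \<le> 0"
      by (intro sum_nonpos) (auto simp: not_less)
    with pos show False by simp
  qed
  have finP: "finite (g ` ?P)"
    by (intro finite_imageI finite_subset[OF _ fin]) auto
  then have Min: "Min (g ` ?P) \<in> g ` ?P"
    using \<open>?P \<noteq> {}\<close> by (intro Min_in) auto
  then obtain n where n: "n \<in> ?P" and gn: "g n = Min (g ` ?P)"
    by (metis (no_types, lifting) imageE)
  have min: "g n \<le> g k" if "k \<in> ?P" for k
    unfolding gn using that finP by (intro Min_le) auto
  have "w * g n \<le> (\<Sum>k\<in>?I. a k / E k) * g n"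
    using wt g by (intro mult_right_mono) auto
  also have "\<dots> \<le> (\<Sum>k\<in>?I. a k / E k * g k)"
    unfolding sum_distrib_right
  proof (intro sum_mono)
    fix k assume k: "k \<in> ?I"
    show "a k / E k * g n \<le> a k / E k * g k"
    proof (cases "0 < a k")
      case True
      then show ?thesis
        using k min[of k] b by (intro mult_left_mono) auto
    next
      case False
      then have "a k = 0" using a(1)[of k] by linarith
      then show ?thesis by simp
    qed
  qed
  finally have "w * g n \<le> (\<Sum>k\<in>?I. a k / E k * g k)" .
  moreover have "0 < n"
    using n I by auto
  ultimately show thesis
    using n fin by (intro that[of n]) auto
qed

lemma good_geometric_subsequence:
  fixes a g :: "nat \<Rightarrow> real"
  defines "E \<equiv> \<lambda>n. \<Sum>k=1..n. a k"
  assumes a: "\<And>k. 0 \<le> a k" "\<And>k. a k \<le> 1" and unb: "filterlim E at_top sequentially"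
    and g: "\<And>k. 0 \<le> g k" and sm: "summable (\<lambda>k. a k / E k * g k)" and q: "1 < q"
  obtains r where "\<forall>\<^sub>F j in sequentially. q ^ j < E (r j) \<and> E (r j) \<le> q ^ Suc j"
    "\<And>j. 0 < a (r j)" "\<And>j. 0 < r j" "summable (\<lambda>j. g (r j))"
proof -
  define w where "w = (q - 1) / (2 * q)"
  have w: "0 < w" using q by (simp add: w_def)
  let ?I = "\<lambda>j. {k. q ^ j < E k \<and> E k \<le> q ^ Suc j}"
  have "\<forall>\<^sub>F j in sequentially. w * q ^ Suc j \<le> q ^ Suc j - q ^ j - 1"
  proof -
    have "filterlim (\<lambda>j. q ^ j) at_top sequentially"
      using q by real_asymp
    then have "\<forall>\<^sub>F j in sequentially. 2 / (q - 1) \<le> q ^ j"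
      by (simp add: filterlim_at_top)
    then show ?thesis
    proof eventually_elim
      case (elim j)
      then have "2 \<le> (q - 1) * q ^ j"
        using q by (simp add: field_simps)
      moreover have "w * q ^ Suc j = (q - 1) * q ^ j / 2"
        using q by (simp add: w_def)
      moreover have "q ^ Suc j - q ^ j = (q - 1) * q ^ j"
        by (simp add: algebra_simps)
      ultimately show ?case by linarith
    qed
  qed
  then obtain J where J: "\<And>j. j \<ge> J \<Longrightarrow> w * q ^ Suc j \<le> q ^ Suc j - q ^ j - 1"
    unfolding eventually_sequentially by blast
  have "\<exists>n. q ^ j < E n \<and> E n \<le> q ^ Suc j \<and> 0 < a n \<and> 0 < n \<and> finite (?I j) \<and>
      w * g n \<le> (\<Sum>k\<in>?I j. a k / E k * g k)" if "j \<ge> J" for j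
  proof -
    have "0 \<le> q ^ j" "q ^ j < q ^ Suc j"
      using q by auto
    note block = good_index_in_block[where a = a and g = g, OF a unb[unfolded E_def] this w J[OF that] g]
    show ?thesis
    proof (rule block, goal_cases)
      case (1 n)
      then show ?case
        unfolding E_def by (intro exI[of _ n] conjI)
    qed
  qed
  then have "\<forall>j. \<exists>n. q ^ (j + J) < E n \<and> E n \<le> q ^ Suc (j + J) \<and> 0 < a n \<and> 0 < n \<and> finite (?I (j + J)) \<and>
      w * g n \<le> (\<Sum>k\<in>?I (j + J). a k / E k * g k)"
    by simp
  from choice[OF this] obtain s where s: "\<And>j. q ^ (j + J) < E (s j)" "\<And>j. E (s j) \<le> q ^ Suc (j + J)"
    "\<And>j. 0 < a (s j)" "\<And>j. 0 < s j" "\<And>j. finite (?I (j + J))"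
    "\<And>j. w * g (s j) \<le> (\<Sum>k\<in>?I (j + J). a k / E k * g k)"
    by blast
  have nn: "0 \<le> a k / E k * g k" for k
    using a g by (simp add: E_def sum_nonneg)
  have "summable (\<lambda>j. w * g (s j))"
  proof (rule summableI_nonneg_bounded)
    fix n
    have "(\<Sum>j<n. w * g (s j)) \<le> (\<Sum>j<n. \<Sum>k\<in>?I (j + J). a k / E k * g k)"
      using s by (intro sum_mono)
    also have "\<dots> = (\<Sum>k\<in>(\<Union>j<n. ?I (j + J)). a k / E k * g k)"
    proof (rule sum.UNION_disjoint[symmetric])
      have less: "?I i \<inter> ?I j = {}" if "i < j" for i j
      proof -
        have "q ^ Suc i \<le> q ^ j"
          using that q by (intro power_increasing) auto
        then show ?thesis by auto
      qed
      have "?I i \<inter> ?I j = {}" if "i \<noteq> j" for i j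
        using that less[of i j] less[of j i] by (cases "i < j") (simp_all add: Int_commute)
      then show "\<forall>i\<in>{..<n}. \<forall>j\<in>{..<n}. i \<noteq> j \<longrightarrow> ?I (i + J) \<inter> ?I (j + J) = {}"
        by simp
    qed (use s in auto)
    also have "\<dots> \<le> (\<Sum>k. a k / E k * g k)"
      using s nn by (intro sum_le_suminf sm) auto
    finally show "(\<Sum>j<n. w * g (s j)) \<le> (\<Sum>k. a k / E k * g k)" .
  qed (use w g in auto)
  then have "summable (\<lambda>j. g (s j))"
    using w summable_cmult_iff[of w "\<lambda>j. g (s j)"] by auto
  then have "summable (\<lambda>j. g (s (j - J)))"
    using summable_iff_shift[of "\<lambda>j. g (s (j - J))" J] by simp
  moreover have "\<forall>\<^sub>F j in sequentially. q ^ j < E (s (j - J)) \<and> E (s (j - J)) \<le> q ^ Suc j"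
    using eventually_ge_at_top[of J] 
    by eventually_elim (use s(1,2) in \<open>metis le_add_diff_inverse2\<close>)
  ultimately show thesis
    using s by (intro that[of "\<lambda>j. s (j - J)"]) auto
qed

section \<open>Mixing of stationary sequences\<close>

lemma shifted_past_event:
  fixes X :: "int \<Rightarrow> 'a \<Rightarrow> 'e::topological_space"
  assumes "G \<in> generated_sigma M X {..k - int m}"
  obtains C where "C \<in> sets (\<Pi>\<^sub>M i\<in>UNIV. borel)" "G = {\<omega>\<in>space M. (\<lambda>i. X (i + k) \<omega>) \<in> C}"
    "{\<omega>\<in>space M. (\<lambda>i. X i \<omega>) \<in> C} \<in> generated_sigma M X {..- int m}"
proof -
  let ?P = "(\<Pi>\<^sub>M i\<in>UNIV. borel) :: (int \<Rightarrow> 'e) measure"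
  let ?Q = "\<lambda>G C. C \<in> sets ?P \<and> G = {\<omega>\<in>space M. (\<lambda>i. X (i + k) \<omega>) \<in> C} \<and>
      {\<omega>\<in>space M. (\<lambda>i. X i \<omega>) \<in> C} \<in> generated_sigma M X {..- int m}"
  have sp: "space ?P = UNIV"
    by (simp add: space_PiM)
  have "\<exists>C. ?Q G C"
    using assms unfolding generated_sigma_def[of M X "{..k - int m}"]
  proof (induction rule: sigma_sets.induct)
    case (Basic G)
    then obtain i A where i: "i \<le> k - int m" and A: "A \<in> sets borel" and G: "G = X i -` A \<inter> space M"
      by auto
    let ?C = "{x \<in> space ?P. x (i - k) \<in> A}"
    have "?C \<in> sets ?P"
      using A by measurable
    moreover have "{\<omega>\<in>space M. (\<lambda>i. X i \<omega>) \<in> ?C} \<in> generated_sigma M X {..- int m}"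
      unfolding generated_sigma_def
    proof (rule sigma_sets.Basic, rule UN_I[of "i - k"])
      show "{\<omega>\<in>space M. (\<lambda>i. X i \<omega>) \<in> ?C} \<in> {X (i - k) -` C \<inter> space M |C. C \<in> sets borel}"
        using A by (intro CollectI exI[of _ A]) (auto simp: sp)
    qed (use i in auto)
    ultimately show ?case
      by (intro exI[of _ ?C]) (auto simp: sp G)
  next
    case Empty
    show ?case
      by (intro exI[of _ "{}"]) (simp add: generated_sigma_def sigma_sets.Empty)
  next
    case (Compl G)
    then obtain C where C: "?Q G C" by blast
    have "{\<omega>\<in>space M. (\<lambda>i. X i \<omega>) \<in> space ?P - C} = space M - {\<omega>\<in>space M. (\<lambda>i. X i \<omega>) \<in> C}"
      by (auto simp: sp)
    then have "{\<omega>\<in>space M. (\<lambda>i. X i \<omega>) \<in> space ?P - C} \<in> generated_sigma M X {..- int m}"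
      using C unfolding generated_sigma_def by (metis (no_types, lifting) sigma_sets.Compl)
    moreover have "space ?P - C \<in> sets ?P"
      using C by blast
    moreover have "space M - G = {\<omega>\<in>space M. (\<lambda>i. X (i + k) \<omega>) \<in> space ?P - C}"
      using C by (auto simp: sp)
    ultimately show ?case by blast
  next
    case (Union G)
    then have "\<forall>i. \<exists>C. ?Q (G i) C" by blast
    from choice[OF this] obtain C where C: "\<And>i. ?Q (G i) (C i)" by blast
    have "{\<omega>\<in>space M. (\<lambda>i. X i \<omega>) \<in> (\<Union>i. C i)} = (\<Union>j. {\<omega>\<in>space M. (\<lambda>i. X i \<omega>) \<in> C j})"
      by auto
    moreover have "(\<Union>j. {\<omega>\<in>space M. (\<lambda>i. X i \<omega>) \<in> C j}) \<in> generated_sigma M X {..- int m}"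
      using C unfolding generated_sigma_def by (intro sigma_sets.Union) blast
    moreover have "(\<Union>i. C i) \<in> sets ?P"
      using C by blast
    moreover have "(\<Union>i. G i) = {\<omega>\<in>space M. (\<lambda>i. X (i + k) \<omega>) \<in> (\<Union>i. C i)}"
      using C by auto
    ultimately show ?case by (intro exI[of _ "\<Union>i. C i"]) simp
  qed
  then show thesis using that by blast
qed

lemma stationary_measure_eq:
  fixes X :: "int \<Rightarrow> 'a \<Rightarrow> 'e::topological_space"
  assumes X: "\<And>i. X i \<in> measurable M borel" and st: "strictly_stationary M X"
    and C: "C \<in> sets (\<Pi>\<^sub>M i\<in>UNIV. borel)"
  shows "emeasure M {\<omega>\<in>space M. (\<lambda>i. X (i + k) \<omega>) \<in> C} = emeasure M {\<omega>\<in>space M. (\<lambda>i. X i \<omega>) \<in> C}"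
proof -
  let ?P = "(\<Pi>\<^sub>M i\<in>UNIV. borel) :: (int \<Rightarrow> 'e) measure"
  have m: "(\<lambda>\<omega> i. X (i + j) \<omega>) \<in> measurable M ?P" for j
    using X by (intro measurable_PiM_single') auto
  have d: "emeasure M {\<omega>\<in>space M. (\<lambda>i. X (i + j) \<omega>) \<in> C} = emeasure (distr M ?P (\<lambda>\<omega> i. X (i + j) \<omega>)) C" for j
    using emeasure_distr[OF m C] by (simp add: vimage_def Int_def conj_commute)
  show ?thesis
    using d[of k] d[of 0] st by (simp add: strictly_stationary_def)
qed

lemma stationary_marginal:
  fixes X :: "int \<Rightarrow> 'a \<Rightarrow> 'e::topological_space"
  assumes X: "\<And>i. X i \<in> measurable M borel" and st: "strictly_stationary M X" and A: "A \<in> sets borel"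
  shows "emeasure (distr M borel (X 0)) A = emeasure M {\<omega>\<in>space M. X k \<omega> \<in> A}"
proof -
  let ?P = "(\<Pi>\<^sub>M i\<in>UNIV. borel) :: (int \<Rightarrow> 'e) measure"
  have "{x \<in> space ?P. x 0 \<in> A} \<in> sets ?P"
    using A by measurable
  then have "{x. x 0 \<in> A} \<in> sets ?P"
    by (simp add: space_PiM)
  from stationary_measure_eq[OF X st this, of k] show ?thesis
    using emeasure_distr[OF X A, of 0] by (simp add: vimage_def Int_def conj_commute)
qed

lemma (in prob_space) covariance_events_le_1: "\<bar>prob (A \<inter> B) - prob A * prob B\<bar> \<le> 1"
proof -
  have "0 \<le> prob A * prob B" "prob A * prob B \<le> 1"
    by (simp_all add: mult_le_one)
  then show ?thesis
    using prob_le_1[of "A \<inter> B"] measure_nonneg[of M "A \<inter> B"] by linarith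
qed

lemma (in prob_space) alpha_inf_1_le_1: "alpha_inf_1 M X n \<le> 1"
  unfolding alpha_inf_1_def strong_mixing_coeff_def
proof (rule cSUP_least)
  have "{} \<in> generated_sigma M X I" for I
    by (simp add: generated_sigma_def sigma_sets.Empty)
  then show "generated_sigma M X {..- int n} \<times> generated_sigma M X {0} \<noteq> {}"
    by blast
qed (auto simp: covariance_events_le_1)

lemma (in prob_space) mixing_bound:
  fixes X :: "int \<Rightarrow> 'a \<Rightarrow> 'e::topological_space"
  assumes X: "\<And>i. X i \<in> measurable M borel" and st: "strictly_stationary M X"
    and G: "G \<in> generated_sigma M X {..k - int m}" and A: "A \<in> sets borel"
  shows "\<bar>prob (G \<inter> {\<omega>\<in>space M. X k \<omega> \<in> A}) - prob G * prob {\<omega>\<in>space M. X k \<omega> \<in> A}\<bar>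
    \<le> alpha_inf_1 M X m"
proof -
  let ?P = "(\<Pi>\<^sub>M i\<in>UNIV. borel) :: (int \<Rightarrow> 'e) measure"
  have sp: "space ?P = UNIV"
    by (simp add: space_PiM)
  obtain C where C: "C \<in> sets ?P" "G = {\<omega>\<in>space M. (\<lambda>i. X (i + k) \<omega>) \<in> C}"
    "{\<omega>\<in>space M. (\<lambda>i. X i \<omega>) \<in> C} \<in> generated_sigma M X {..- int m}"
    by (rule shifted_past_event[OF G])
  let ?G = "{\<omega>\<in>space M. (\<lambda>i. X i \<omega>) \<in> C}" and ?H = "{\<omega>\<in>space M. X 0 \<omega> \<in> A}"
  have "{x \<in> space ?P. x 0 \<in> A} \<in> sets ?P"
    using A by measurable
  then have H: "{x. x 0 \<in> A} \<in> sets ?P"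
    by (simp add: sp)
  have "prob {\<omega>\<in>space M. X k \<omega> \<in> A} = prob ?H"
    using stationary_measure_eq[OF X st H, of k] by (simp add: measure_def)
  moreover have "prob G = prob ?G"
    using stationary_measure_eq[OF X st C(1), of k] by (simp add: C(2) measure_def)
  moreover have "prob (G \<inter> {\<omega>\<in>space M. X k \<omega> \<in> A}) = prob (?G \<inter> ?H)"
  proof -
    have "G \<inter> {\<omega>\<in>space M. X k \<omega> \<in> A} = {\<omega>\<in>space M. (\<lambda>i. X (i + k) \<omega>) \<in> C \<inter> {x. x 0 \<in> A}}"
      by (auto simp: C(2))
    moreover have "?G \<inter> ?H = {\<omega>\<in>space M. (\<lambda>i. X i \<omega>) \<in> C \<inter> {x. x 0 \<in> A}}"
      by auto
    moreover have "C \<inter> {x. x 0 \<in> A} \<in> sets ?P"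
      using C(1) H by blast
    ultimately show ?thesis
      using stationary_measure_eq[OF X st, of "C \<inter> {x. x 0 \<in> A}" k] by (simp add: measure_def)
  qed
  moreover have "\<bar>prob (?G \<inter> ?H) - prob ?G * prob ?H\<bar> \<le> alpha_inf_1 M X m"
  proof -
    let ?f = "\<lambda>(A, B). \<bar>prob (A \<inter> B) - prob A * prob B\<bar>"
    have bdd: "bdd_above (?f ` S)" for S
      by (rule bdd_aboveI2[of _ _ 1]) (auto simp: covariance_events_le_1)
    have "?H \<in> generated_sigma M X {0}"
      unfolding generated_sigma_def using A by (intro sigma_sets.Basic) auto
    with C(3) have "(?G, ?H) \<in> generated_sigma M X {..- int m} \<times> generated_sigma M X {0}"
      by simp
    from cSUP_upper[OF this bdd] show ?thesis
      by (simp add: alpha_inf_1_def strong_mixing_coeff_def)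
  qed
  ultimately show ?thesis by simp
qed

lemma (in prob_space) stationary_hits_decomposition:
  fixes X :: "int \<Rightarrow> 'a \<Rightarrow> 'e::topological_space"
  assumes X: "\<And>i. X i \<in> measurable M borel" and st: "strictly_stationary M X"
    and A: "\<And>k. k > 0 \<Longrightarrow> A k \<in> sets borel"
    and B: "\<And>k. k > 0 \<Longrightarrow> B k = {\<omega> \<in> space M. X (int k) \<omega> \<in> A k}"
  obtains D R :: "'a \<Rightarrow> real" where
    "\<And>x. hits B n x - (\<Sum>k=1..n. prob (B k)) = D x + R x"
    "D \<in> borel_measurable M" "integrable M (\<lambda>x. (D x)\<^sup>2)" "integrable M R"
    "(\<integral>x. (D x)\<^sup>2 \<partial>M) \<le> 2 * real m * (\<Sum>k=1..n. prob (B k))"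
    "(\<integral>x. \<bar>R x\<bar> \<partial>M) \<le> 2 * real n * alpha_inf_1 M X m"
proof -
  let ?g = "\<lambda>i. \<Union>j\<in>{..i}. {X j -` C \<inter> space M |C. C \<in> sets borel}"
  define F where "F i = sigma (space M) (?g i)" for i
  have sF: "sets (F i) = generated_sigma M X {..i}" for i
    unfolding F_def generated_sigma_def by (rule sets_measure_of) auto
  have F: "subalgebra M (F i)" for i
  proof -
    have "?g i \<subseteq> sets M"
      using measurable_sets[OF X] by auto
    then show ?thesis
      unfolding subalgebra_def sF generated_sigma_def
      using sets.sigma_sets_subset[of "?g i" M] by (simp add: F_def space_measure_of_conv)
  qed
  show thesis
  proof (rule hits_decomposition[of F B m "alpha_inf_1 M X m" n thesis])
    show "subalgebra M (F i)" for i by (rule F)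
    show "sets (F i) \<subseteq> sets (F j)" if "i \<le> j" for i j
      unfolding sF generated_sigma_def using that by (intro sigma_sets_mono' UN_mono) auto
    show "B k \<in> sets (F (int k))" if k: "k > 0" for k
      unfolding sF generated_sigma_def B[OF k] using A[OF k]
      by (intro sigma_sets.Basic) (auto simp: vimage_def Int_def conj_commute)
    show "\<bar>prob (G \<inter> B k) - prob G * prob (B k)\<bar> \<le> alpha_inf_1 M X m"
      if k: "k > 0" and G: "G \<in> sets (F (int k - int m))" for k G
      using mixing_bound[OF X st G[unfolded sF] A[OF k]] by (simp add: B[OF k])
  qed (rule that)
qed

section \<open>Convergence of the ratio\<close>

lemma (in prob_space) L1_deviation_bound:
  fixes S D R :: "'a \<Rightarrow> real"
  assumes S: "\<And>x. S x - e = D x + R x" and e: "0 < e"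
    and D: "D \<in> borel_measurable M" "integrable M (\<lambda>x. (D x)\<^sup>2)" and R: "integrable M R"
    and d: "(\<integral>x. (D x)\<^sup>2 \<partial>M) \<le> d * e" and r: "(\<integral>x. \<bar>R x\<bar> \<partial>M) \<le> r"
  shows "(\<integral>x. \<bar>S x / e - 1\<bar> \<partial>M) \<le> sqrt (d / e) + r / e"
proof -
  have iD: "integrable M D"
    using D by (rule square_integrable_imp_integrable)
  have "(\<integral>x. \<bar>D x\<bar> \<partial>M)\<^sup>2 \<le> (\<integral>x. (D x)\<^sup>2 \<partial>M)"
    using variance_eq[of "\<lambda>x. \<bar>D x\<bar>"] variance_positive[of "\<lambda>x. \<bar>D x\<bar>"] iD D(2) by simp
  with d have "(\<integral>x. \<bar>D x\<bar> \<partial>M) \<le> sqrt (d * e)"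
    by (intro real_le_rsqrt) simp
  also have "\<dots> = sqrt (d / e) * e"
    using e by (simp add: real_sqrt_mult real_sqrt_divide real_div_sqrt field_simps)
  finally have d': "(\<integral>x. \<bar>D x\<bar> \<partial>M) \<le> sqrt (d / e) * e" .
  have "\<bar>S x / e - 1\<bar> = \<bar>D x + R x\<bar> / e" for x
    using e by (simp flip: S add: abs_if field_simps)
  then have "(\<integral>x. \<bar>S x / e - 1\<bar> \<partial>M) = (\<integral>x. \<bar>D x + R x\<bar> / e \<partial>M)"
    by simp
  also have "\<dots> \<le> (\<integral>x. (\<bar>D x\<bar> + \<bar>R x\<bar>) / e \<partial>M)"
    using e iD R by (intro integral_mono divide_right_mono abs_triangle_ineq) auto
  also have "\<dots> = ((\<integral>x. \<bar>D x\<bar> \<partial>M) + (\<integral>x. \<bar>R x\<bar> \<partial>M)) / e"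
    using iD R by simp
  also have "\<dots> \<le> (sqrt (d / e) * e + r) / e"
    using d' r e by (intro divide_right_mono add_mono) auto
  also have "\<dots> = sqrt (d / e) + r / e"
    using e by (simp add: add_divide_distrib)
  finally show ?thesis .
qed

lemma AE_tendsto_zero_if_summable_integral:
  fixes h :: "nat \<Rightarrow> 'a \<Rightarrow> real"
  assumes h: "\<And>j. integrable M (h j)" "\<And>j x. 0 \<le> h j x" and sm: "summable (\<lambda>j. \<integral>x. h j x \<partial>M)"
  shows "AE x in M. (\<lambda>j. h j x) \<longlonglongrightarrow> 0"
proof -
  have [measurable]: "h j \<in> borel_measurable M" for j
    using h(1) by auto
  have "(\<integral>\<^sup>+x. (\<Sum>j. ennreal (h j x)) \<partial>M) = (\<Sum>j. \<integral>\<^sup>+x. ennreal (h j x) \<partial>M)"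
    by (rule nn_integral_suminf) measurable
  also have "\<dots> = (\<Sum>j. ennreal (\<integral>x. h j x \<partial>M))"
    using h by (intro suminf_cong nn_integral_eq_integral) auto
  also have "\<dots> \<noteq> \<infinity>"
    using h sm by (subst suminf_ennreal2) auto
  finally have "AE x in M. (\<Sum>j. ennreal (h j x)) \<noteq> \<infinity>"
    by (intro nn_integral_noteq_infinite) measurable
  then show ?thesis
  proof eventually_elim
    case (elim x)
    then have "summable (\<lambda>j. h j x)"
      using h(2) by (intro summable_suminf_not_top) auto
    then show ?case by (rule summable_LIMSEQ_zero)
  qed
qed

lemma (in prob_space) AE_ratio_tendsto_one:
  fixes B :: "nat \<Rightarrow> 'a set" and E \<alpha> g :: "nat \<Rightarrow> real"
  assumes E_def: "E = (\<lambda>n. \<Sum>k=1..n. prob (B k))"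
    and decomp: "\<And>n m. \<exists>D R :: 'a \<Rightarrow> real. (\<forall>x. hits B n x - E n = D x + R x) \<and>
      D \<in> borel_measurable M \<and> integrable M (\<lambda>x. (D x)\<^sup>2) \<and> integrable M R \<and>
      (\<integral>x. (D x)\<^sup>2 \<partial>M) \<le> 2 * real m * E n \<and> (\<integral>x. \<bar>R x\<bar> \<partial>M) \<le> 2 * real n * \<alpha> m"
    and unb: "filterlim E at_top sequentially"
    and g: "\<And>k. k > 0 \<Longrightarrow> 0 \<le> g k" "summable (\<lambda>k. prob (B (Suc k)) / E (Suc k) * g (Suc k))"
    and m: "\<And>k. k > 0 \<Longrightarrow> prob (B k) > 0 \<Longrightarrow>
              \<exists>m. real m / E k \<le> g k \<and> real k * \<alpha> m \<le> E k * g k"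
  shows "AE x in M. (\<lambda>n. hits B n x / E n) \<longlonglongrightarrow> 1"
proof -
  define a where "a k = (if k = 0 then 0 else prob (B k))" for k
  define g' where "g' k = (if k = 0 then 0 else g k)" for k
  have E: "E = (\<lambda>n. \<Sum>k=1..n. a k)"
    by (auto simp: E_def a_def intro!: sum.cong)
  have a: "0 \<le> a k" "a k \<le> 1" for k
    by (auto simp: a_def)
  have monoE: "mono E"
    unfolding E using a by (intro monoI sum_mono2) auto
  have sm: "summable (\<lambda>k. a k / E k * g' k)"
    using g(2) by (subst summable_Suc_iff[symmetric]) (simp add: a_def g'_def)
  have "AE x in M. \<forall>\<^sub>F n in sequentially. 1 / q ^ 3 \<le> hits B n x / E n \<and> hits B n x / E n \<le> q ^ 3"
    if q: "1 < q" for q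
  proof -
    have g'0: "0 \<le> g' k" for k
      using g(1) by (simp add: g'_def)
    obtain r where r: "\<forall>\<^sub>F j in sequentially. q ^ j < E (r j) \<and> E (r j) \<le> q ^ Suc j"
      "\<And>j. 0 < a (r j)" "\<And>j. 0 < r j" "summable (\<lambda>j. g' (r j))"
      using good_geometric_subsequence[where a = a and g = g', OF a unb[unfolded E] g'0 sm[unfolded E] q]
      unfolding E by blast
    have Er: "0 < E (r j)" for j
    proof -
      have "a (r j) \<le> E (r j)"
        unfolding E using a r(3)[of j] by (intro member_le_sum) auto
      with r(2)[of j] show ?thesis by linarith
    qed
    have "\<exists>D R :: 'a \<Rightarrow> real. (\<forall>x. hits B (r j) x - E (r j) = D x + R x) \<and>
        D \<in> borel_measurable M \<and> integrable M (\<lambda>x. (D x)\<^sup>2) \<and> integrable M R \<and>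
        (\<integral>x. (D x)\<^sup>2 \<partial>M) \<le> 2 * g' (r j) * (E (r j))\<^sup>2 \<and> (\<integral>x. \<bar>R x\<bar> \<partial>M) \<le> 2 * g' (r j) * E (r j)" for j
    proof -
      have p: "r j > 0" "prob (B (r j)) > 0" "g' (r j) = g (r j)"
        using r(2,3)[of j] by (auto simp: a_def g'_def)
      obtain m where m: "real m / E (r j) \<le> g' (r j)" "real (r j) * \<alpha> m \<le> E (r j) * g' (r j)"
        using m[OF p(1,2)] p(3) by auto
      have "2 * real m * E (r j) \<le> 2 * g' (r j) * (E (r j))\<^sup>2"
        using m(1) Er[of j] by (simp add: field_simps power2_eq_square)
      moreover have "2 * real (r j) * \<alpha> m \<le> 2 * g' (r j) * E (r j)"
        using m(2) by (simp add: mult_ac)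
      ultimately show ?thesis
        using decomp[of "r j" m] by (meson order_trans)
    qed
    then obtain D R :: "nat \<Rightarrow> 'a \<Rightarrow> real" where
      DR: "\<And>j x. hits B (r j) x - E (r j) = D j x + R j x"
      and D: "\<And>j. integrable M (\<lambda>x. (D j x)\<^sup>2)" and R: "\<And>j. integrable M (R j)"
      and bD: "\<And>j. (\<integral>x. (D j x)\<^sup>2 \<partial>M) \<le> 2 * g' (r j) * (E (r j))\<^sup>2"
      and bR: "\<And>j. (\<integral>x. \<bar>R j x\<bar> \<partial>M) \<le> 2 * g' (r j) * E (r j)"
      by metis
    define h where "h j x = (D j x)\<^sup>2 / (E (r j))\<^sup>2 + \<bar>R j x\<bar> / E (r j)" for j x
    have "AE x in M. (\<lambda>j. h j x) \<longlonglongrightarrow> 0"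
    proof (rule AE_tendsto_zero_if_summable_integral)
      show "integrable M (h j)" for j
        unfolding h_def using D R by simp
      show h0: "0 \<le> h j x" for j x
        using Er[of j] by (simp add: h_def)
      have "(\<integral>x. h j x \<partial>M) \<le> 4 * g' (r j)" for j
      proof -
        have "(\<integral>x. h j x \<partial>M) = (\<integral>x. (D j x)\<^sup>2 \<partial>M) / (E (r j))\<^sup>2 + (\<integral>x. \<bar>R j x\<bar> \<partial>M) / E (r j)"
          unfolding h_def using D R by simp
        also have "\<dots> \<le> 2 * g' (r j) + 2 * g' (r j)"
          using bD[of j] bR[of j] Er[of j] by (intro add_mono) (simp_all add: divide_le_eq)
        finally show ?thesis by simp
      qed
      with h0 show "summable (\<lambda>j. \<integral>x. h j x \<partial>M)"
        by (intro summable_comparison_test'[OF summable_mult[OF r(4), of 4], of 0])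
          (simp add: Bochner_Integration.integral_nonneg)
    qed
    then show ?thesis
    proof eventually_elim
      case (elim x)
      have "(\<lambda>j. sqrt ((D j x)\<^sup>2 / (E (r j))\<^sup>2)) \<longlonglongrightarrow> sqrt 0"
        using Er by (intro tendsto_real_sqrt tendsto_sandwich[OF _ _ tendsto_const elim])
          (auto simp: h_def less_imp_le)
      moreover have "sqrt ((D j x)\<^sup>2 / (E (r j))\<^sup>2) = \<bar>D j x / E (r j)\<bar>" for j
        by (simp flip: power_divide)
      ultimately have "(\<lambda>j. D j x / E (r j)) \<longlonglongrightarrow> 0"
        by (simp only: real_sqrt_zero tendsto_rabs_zero_iff)
      moreover have "(\<lambda>j. \<bar>R j x\<bar> / E (r j)) \<longlonglongrightarrow> 0"
        using Er by (intro tendsto_sandwich[OF _ _ tendsto_const elim])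
          (auto simp: h_def less_imp_le)
      then have "(\<lambda>j. \<bar>R j x / E (r j)\<bar>) \<longlonglongrightarrow> 0"
        using Er by (simp add: abs_divide abs_of_pos)
      then have "(\<lambda>j. R j x / E (r j)) \<longlonglongrightarrow> 0"
        by (simp only: tendsto_rabs_zero_iff)
      ultimately have "(\<lambda>j. 1 + (D j x / E (r j) + R j x / E (r j))) \<longlonglongrightarrow> 1 + (0 + 0)"
        by (intro tendsto_intros)
      moreover have "hits B (r j) x / E (r j) = 1 + (D j x / E (r j) + R j x / E (r j))" for j
        using DR[of j x] Er[of j] by (simp add: field_simps)
      ultimately have lim: "(\<lambda>j. hits B (r j) x / E (r j)) \<longlonglongrightarrow> 1"
        by simp
      show ?case
      proof (rule ratio_bounds_from_subsequence[OF _ _ monoE unb q r(1) lim])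
        show "mono (\<lambda>n. hits B n x)"
          unfolding hits_def by (intro monoI sum_mono2) auto
        show "0 \<le> hits B n x" for n
          unfolding hits_def by (intro sum_nonneg) auto
      qed
    qed
  qed
  then have "AE x in M. \<forall>i :: nat. \<forall>\<^sub>F n in sequentially.
      1 / (1 + 1 / real (Suc i)) ^ 3 \<le> hits B n x / E n \<and> hits B n x / E n \<le> (1 + 1 / real (Suc i)) ^ 3"
    unfolding AE_all_countable by simp
  then show ?thesis
    by eventually_elim (rule tendsto_one_if_power_bounds, blast)
qed

lemma partial_sums_at_top:
  fixes f :: "nat \<Rightarrow> real"
  assumes f: "\<And>k. k > 0 \<Longrightarrow> 0 \<le> f k" and inf: "(\<Sum>k. ennreal (f (Suc k))) = \<infinity>"
  shows "filterlim (\<lambda>n. \<Sum>k=1..n. f k) at_top sequentially"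
  unfolding filterlim_at_top
proof
  fix Z :: real
  have "\<exists>N. Z < (\<Sum>k<N. f (Suc k))"
  proof (rule ccontr)
    assume "\<nexists>N. Z < (\<Sum>k<N. f (Suc k))"
    then have "summable (\<lambda>k. f (Suc k))"
      using f by (intro summableI_nonneg_bounded[where x = Z]) (auto simp: not_less)
    with f have "(\<Sum>k. ennreal (f (Suc k))) \<noteq> \<infinity>"
      by (subst suminf_ennreal2) auto
    with inf show False by simp
  qed
  then obtain N where N: "Z < (\<Sum>k<N. f (Suc k))" ..
  show "\<forall>\<^sub>F n in sequentially. Z \<le> (\<Sum>k=1..n. f k)"
  proof (rule eventually_sequentiallyI[of N])
    fix n assume "N \<le> n"
    then have "(\<Sum>k=1..N. f k) \<le> (\<Sum>k=1..n. f k)"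
      using f by (intro sum_mono2) auto
    with N show "Z \<le> (\<Sum>k=1..n. f k)"
      by (simp add: sum.atLeast1_atMost_eq)
  qed
qed

lemma seq_inverse_attained:
  assumes "seq_inverse v u = enat m"
  shows "v m \<le> u"
proof -
  let ?S = "{enat n | n. v n \<le> u}"
  have "?S \<noteq> {}"
    using assms by (auto simp: seq_inverse_def Inf_enat_def split: if_splits)
  then have "Inf ?S \<in> ?S"
    by (metis (no_types, lifting) ex_in_conv wellorder_InfI)
  then show ?thesis
    using assms by (auto simp: seq_inverse_def)
qed

theorem theorem3p3:
  fixes M :: "'a measure"
    and X :: "int \<Rightarrow> 'a \<Rightarrow> 'e::polish_space"
    and \<mu> :: "'e measure"
    and A :: "nat \<Rightarrow> 'e set"
    and B :: "nat \<Rightarrow> 'a set"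
    and E :: "nat \<Rightarrow> real"
    and \<alpha> :: "nat \<Rightarrow> real"
  assumes "prob_space M"
    and "\<And>i. X i \<in> measurable M borel"
    and "strictly_stationary M X"
    and "\<alpha> = alpha_inf_1 M X"
    and "\<mu> = distr M borel (X 0)"
    and "\<And>k. k > 0 \<Longrightarrow> A k \<in> sets borel"
    and "measure \<mu> (A 1) > 0"
    and "(\<Sum>k. emeasure \<mu> (A (Suc k))) = \<infinity>"
    and "\<And>k. k > 0 \<Longrightarrow> B k = {\<omega> \<in> space M. X (int k) \<omega> \<in> A k}"
    and "\<And>n. E n = (\<Sum>k=1..n. measure \<mu> (A k))"
  shows "((\<lambda>n. fun_inverse (\<lambda>x. \<alpha> (nat \<lfloor>x\<rfloor>) / x) (1 / real n) / E n) \<longlonglongrightarrow> 0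
           \<longrightarrow> L1_Borel_Cantelli M B)
       \<and> ((\<exists>u :: nat \<Rightarrow> real. (\<forall>n>0. u n > 0)
             \<and> summable (\<lambda>n. measure \<mu> (A (Suc n)) / E (Suc n) * u (Suc n))
             \<and> (\<Sum>n. ennreal (measure \<mu> (A (Suc n)) / (E (Suc n))\<^sup>2)
                     * ennreal_of_enat (seq_inverse \<alpha> (E (Suc n) * u (Suc n) / real (Suc n)))) < \<infinity>)
           \<longrightarrow> strongly_Borel_Cantelli M B)"
proof -
  interpret prob_space M by fact
  note X [measurable] = assms(2) and st = assms(3) and \<alpha> = assms(4) and \<mu> = assms(5)
    and A = assms(6) and B = assms(9) and E = assms(10)
  have BM: "B k \<in> sets M" if "k > 0" for k
    unfolding B[OF that] using A[OF that] by measurable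
  have eB: "emeasure \<mu> (A k) = emeasure M (B k)" if "k > 0" for k
    unfolding \<mu> B[OF that] using stationary_marginal[OF X st A[OF that]] .
  then have pB: "measure \<mu> (A k) = prob (B k)" if "k > 0" for k
    using that by (simp add: measure_def)
  have E': "E = (\<lambda>n. \<Sum>k=1..n. prob (B k))"
    by (auto simp: E pB intro!: sum.cong)
  have ex: "expected_hits M B n = E n" for n
    unfolding expected_hits_def hits_def E' using BM
    by (subst Bochner_Integration.integral_sum) (auto simp: emeasure_eq_measure)
  have inf: "(\<Sum>k. emeasure M (B (Suc k))) = \<infinity>"
    using assms(8) by (simp add: eB)
  have unb: "filterlim E at_top sequentially"
    unfolding E' using inf by (intro partial_sums_at_top) (simp_all add: emeasure_eq_measure)
  have E0: "0 < E n" if "n > 0" for n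
  proof -
    have "prob (B 1) \<le> E n"
      unfolding E' using that by (intro member_le_sum) auto
    with assms(7) show ?thesis by (simp add: pB)
  qed
  have decomp: "\<exists>D R :: 'a \<Rightarrow> real. (\<forall>x. hits B n x - E n = D x + R x) \<and>
      D \<in> borel_measurable M \<and> integrable M (\<lambda>x. (D x)\<^sup>2) \<and> integrable M R \<and>
      (\<integral>x. (D x)\<^sup>2 \<partial>M) \<le> 2 * real m * E n \<and> (\<integral>x. \<bar>R x\<bar> \<partial>M) \<le> 2 * real n * \<alpha> m" for n m
    unfolding E' \<alpha>
    by (rule stationary_hits_decomposition[OF X st A B, where n = n and m = m]) blast+
  have part1: "L1_Borel_Cantelli M B"
    if lim: "(\<lambda>n. fun_inverse (\<lambda>x. \<alpha> (nat \<lfloor>x\<rfloor>) / x) (1 / real n) / E n) \<longlonglongrightarrow> 0"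
  proof -
    define y where "y n = fun_inverse (\<lambda>x. \<alpha> (nat \<lfloor>x\<rfloor>) / x) (1 / real n) + 1" for n
    have bound: "(\<integral>x. \<bar>hits B n x / E n - 1\<bar> \<partial>M) \<le> sqrt (2 * (y n / E n)) + 2 * (y n / E n)"
      if n: "n > 0" for n
    proof -
      let ?S = "{x. x > 0 \<and> \<alpha> (nat \<lfloor>x\<rfloor>) / x \<le> 1 / real n}"
      have "real n \<in> ?S"
        using n by (auto simp: \<alpha> intro!: divide_right_mono alpha_inf_1_le_1)
      moreover have "Inf ?S < y n"
        by (simp add: y_def fun_inverse_def)
      ultimately obtain x where x: "0 < x" "\<alpha> (nat \<lfloor>x\<rfloor>) / x \<le> 1 / real n" "x < y n"
        using cInf_lessD[of ?S "y n"] by blast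
      define m where "m = nat \<lfloor>x\<rfloor>"
      have m: "real m \<le> y n"
        using x by (simp add: m_def) linarith
      have \<alpha>m: "real n * \<alpha> m \<le> y n"
        using x n by (simp add: m_def field_simps)
      obtain D R where "\<And>x. hits B n x - E n = D x + R x"
        "D \<in> borel_measurable M" "integrable M (\<lambda>x. (D x)\<^sup>2)" "integrable M R"
        "(\<integral>x. (D x)\<^sup>2 \<partial>M) \<le> 2 * real m * E n" "(\<integral>x. \<bar>R x\<bar> \<partial>M) \<le> 2 * real n * \<alpha> m"
        using decomp[of n m] by blast
      then have "(\<integral>x. \<bar>hits B n x / E n - 1\<bar> \<partial>M) \<le> sqrt (2 * real m / E n) + 2 * real n * \<alpha> m / E n"
        using E0[OF n] by (intro L1_deviation_bound) auto
      also have "\<dots> \<le> sqrt (2 * (y n / E n)) + 2 * (y n / E n)"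
        using m \<alpha>m E0[OF n] by (intro add_mono real_sqrt_le_mono) (simp_all add: divide_right_mono)
      finally show ?thesis .
    qed
    have "(\<lambda>n. 1 / E n) \<longlonglongrightarrow> 0"
      using unb by (intro tendsto_divide_0[OF tendsto_const]) (rule filterlim_at_top_imp_at_infinity)
    from tendsto_add[OF lim this] have "(\<lambda>n. y n / E n) \<longlonglongrightarrow> 0"
      by (simp add: y_def add_divide_distrib)
    then have "(\<lambda>n. sqrt (2 * (y n / E n)) + 2 * (y n / E n)) \<longlonglongrightarrow> sqrt (2 * 0) + 2 * 0"
      by (intro tendsto_intros)
    then have lim0: "(\<lambda>n. sqrt (2 * (y n / E n)) + 2 * (y n / E n)) \<longlonglongrightarrow> 0"
      by simp
    have "(\<lambda>n. \<integral>x. \<bar>hits B n x / E n - 1\<bar> \<partial>M) \<longlonglongrightarrow> 0"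
    proof (rule tendsto_sandwich[OF _ _ tendsto_const lim0])
      show "\<forall>\<^sub>F n in sequentially. (\<integral>x. \<bar>hits B n x / E n - 1\<bar> \<partial>M) \<le> sqrt (2 * (y n / E n)) + 2 * (y n / E n)"
        using eventually_gt_at_top[of 0] by eventually_elim (rule bound)
    qed (simp add: Bochner_Integration.integral_nonneg)
    with BM inf show ?thesis
      by (simp add: L1_Borel_Cantelli_def ex)
  qed
  have part2: "strongly_Borel_Cantelli M B"
    if u: "\<forall>n>0. u n > 0" "summable (\<lambda>n. measure \<mu> (A (Suc n)) / E (Suc n) * u (Suc n))"
      "(\<Sum>n. ennreal (measure \<mu> (A (Suc n)) / (E (Suc n))\<^sup>2)
          * ennreal_of_enat (seq_inverse \<alpha> (E (Suc n) * u (Suc n) / real (Suc n)))) < \<infinity>" for u :: "nat \<Rightarrow> real"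
  proof -
    define s where "s n = seq_inverse \<alpha> (E n * u n / real n)" for n
    define m where "m n = (if prob (B n) > 0 then the_enat (s n) else 0)" for n
    let ?t = "\<lambda>n. ennreal (prob (B (Suc n)) / (E (Suc n))\<^sup>2) * ennreal_of_enat (s (Suc n))"
    have fin: "(\<Sum>n. ?t n) < \<infinity>"
      using u(3) by (simp add: s_def pB)
    have s: "s n = enat (m n)" if n: "n > 0" "prob (B n) > 0" for n
    proof -
      obtain k where k: "n = Suc k"
        using n(1) gr0_implies_Suc by blast
      have "?t k \<le> (\<Sum>n. ?t n)"
        using sum_le_suminf[of ?t "{k}"] by simp
      with fin have "?t k < \<infinity>"
        by (rule le_less_trans[rotated])
      moreover have "0 < prob (B n) / (E n)\<^sup>2"
        using n E0[OF n(1)] by simp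
      then have "ennreal (prob (B n) / (E n)\<^sup>2) \<noteq> 0"
        by (simp add: ennreal_eq_0_iff)
      ultimately have "s n \<noteq> \<infinity>"
        unfolding k by (intro notI) (simp add: ennreal_mult_top)
      then show ?thesis
        using n by (auto simp: m_def)
    qed
    have t: "?t n = ennreal (prob (B (Suc n)) / E (Suc n) * (real (m (Suc n)) / E (Suc n)))" for n
    proof (cases "prob (B (Suc n)) > 0")
      case True
      then show ?thesis
        using s[of "Suc n"] E0[of "Suc n"]
        by (simp add: ennreal_of_nat_eq_real_of_nat ennreal_mult[symmetric] power2_eq_square)
    next
      case False
      then have "prob (B (Suc n)) = 0"
        using measure_nonneg[of M "B (Suc n)"] by linarith
      then show ?thesis by simp
    qed
    have "summable (\<lambda>n. prob (B (Suc n)) / E (Suc n) * (real (m (Suc n)) / E (Suc n)))"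
      using fin E0 unfolding t by (intro summable_suminf_not_top) (auto simp: less_imp_le)
    from summable_add[OF u(2) this]
    have sm: "summable (\<lambda>n. prob (B (Suc n)) / E (Suc n) * (u (Suc n) + real (m (Suc n)) / E (Suc n)))"
      by (simp add: pB algebra_simps)
    have "AE x in M. (\<lambda>n. hits B n x / E n) \<longlonglongrightarrow> 1"
    proof (rule AE_ratio_tendsto_one[OF E' decomp unb, where g = "\<lambda>n. u n + real (m n) / E n"])
      fix k :: nat assume k: "k > 0"
      have uk: "0 < u k"
        using u(1) k by simp
      with E0[OF k] show "0 \<le> u k + real (m k) / E k" by simp
      assume p: "prob (B k) > 0"
      have "\<alpha> (m k) \<le> E k * u k / real k"
        using s[OF k p] by (intro seq_inverse_attained) (simp add: s_def)
      then have "real k * \<alpha> (m k) \<le> E k * u k"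
        using k by (simp add: field_simps)
      also have "\<dots> \<le> E k * (u k + real (m k) / E k)"
        using E0[OF k] by (intro mult_left_mono) auto
      finally show "\<exists>m'. real m' / E k \<le> u k + real (m k) / E k \<and>
          real k * \<alpha> m' \<le> E k * (u k + real (m k) / E k)"
        using uk by (intro exI[of _ "m k"]) auto
    qed (rule sm)
    with BM inf show ?thesis
      by (simp add: strongly_Borel_Cantelli_def ex)
  qed
  show ?thesis
    using part1 part2 by blast
qed

end
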